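(* Let $n, k_1, k_2$ be nonnegative integers such that $k = k_1 + 2k_2 \leq n$, and let $\tau = \tau_{n,k_1,k_2}$ be the corresponding lopsided octopus. Then the polynomial $h(\tau)$ is $\gamma$-positive, i.e. there are nonnegative numbers $\gamma_j(\tau)$ with $$h(\tau, t) = \sum_{j=0}^{\lfloor n/2 \rfloor} \gamma_j(\tau)\, t^j (1+t)^{n-2j},$$ and for any $j$ with $0 \leq j \leq \lfloor n/2 \rfloor$ we have $$\gamma_j(\tau) = \sum_{i=0}^{k_2} 2^i \binom{k_2}{i} \binom{n-k}{j-i} \binom{n-j-i}{j-i}.$$
   Context: Notation: $[m] = \{1, 2, \ldots, m\}$ and $[a,b] = \{a, a+1, \ldots, b\}$ (empty if $a > b$). Binomial coefficients $\binom{a}{b}$ with $b < 0$ are $0$. An arbor of size $n$ is a rooted tree whose vertices are the blocks of a partition of $[n]$. For a vertex $v$ of an arbor, $\mathcal{D}(v) \subseteq [n]$ denotes the union of all descendants of $v$, including $v$ itself. For an arbor $\tau$ of size $n$, the polytope $\mathcal{Q}_\tau \subset \mathbb{R}^n$ is defined by the inequalities $x_i \geq 0$ for all $i \in [n]$ and $\sum_{i \in \mathcal{D}(v)} x_i \leq |\mathcal{D}(v)|$ for all vertices $v$ of $\tau$. The polynomial $h(\tau)$ is $$h(\tau, t) = \sum_{x \in \mathcal{Q}_\tau \cap \mathbb{Z}^n} t^{|\{i \in [n] : x_i \neq 0\}|}.$$ For an arbor $\tau$ of size $n$, $h(\tau)$ is called $\gamma$-positive if there are nonnegative numbers $\gamma_j(\tau)$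 with $h(\tau,t) = \sum_{j=0}^{\lfloor n/2 \rfloor} \gamma_j(\tau) t^j (1+t)^{n-2j}$ (such coefficients are unique if they exist). For nonnegative integers $n, k_1, k_2$ with $k = k_1 + 2k_2 \leq n$, the lopsided octopus $\tau_{n,k_1,k_2}$ is the arbor of size $n$ with root $[k+1, n]$ and with the following leaves attached to the root: the singletons $\{i\}$ for $i \in [k_1]$, and the doubletons $\{i, i+1\}$ for $i \in \{k_1+1, k_1+3, \ldots, k_1+2k_2-1\}$. (When $k = n$ the root is the empty set, which is allowed.) Explicitly, $\mathcal{Q}_{\tau_{n,k_1,k_2}} \cap \mathbb{Z}^n$ is the set of integer tuples $(x_1, \ldots, x_n)$ with $x_i \geq 0$ for all $i \in [n]$; $x_i \leq 1$ for $i \in [k_1]$; $x_i + x_{i+1} \leq 2$ for $i \in \{k_1+1, k_1+3, \ldots, k_1+2k_2-1\}$; and $x_1 + x_2 + \cdots + x_n \leq n$. *)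

theory Defs
  imports Complex_Main "HOL-Library.FuncSet" "HOL-Library.Disjoint_Sets"
    "HOL-Computational_Algebra.Polynomial"
begin

text \<open>An arbor is given by its set of vertices (the blocks), its root, and the set of
  pairs (child, parent).\<close>

record arbor =
  verts :: "nat set set"
  root_vertex :: "nat set"
  parent :: "(nat set \<times> nat set) set"

text \<open>The blocks are nonempty, except that the root may be the empty set.\<close>

definition is_arbor :: "nat \<Rightarrow> arbor \<Rightarrow> bool" where
  "is_arbor n \<tau> \<longleftrightarrow>
     \<Union>(verts \<tau>) = {1..n} \<and> disjoint (verts \<tau>) \<and> ({} \<in> verts \<tau> \<longrightarrow> root_vertex \<tau> = {}) \<and>
     root_vertex \<tau> \<in> verts \<tau> \<and>
     parent \<tau> \<subseteq> (verts \<tau> - {root_vertex \<tau>}) \<times> verts \<tau> \<and>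
     (\<forall>v \<in> verts \<tau> - {root_vertex \<tau>}. \<exists>!w. (v, w) \<in> parent \<tau>) \<and>
     (\<forall>v \<in> verts \<tau>. (v, root_vertex \<tau>) \<in> (parent \<tau>)\<^sup>*)"

definition desc :: "arbor \<Rightarrow> nat set \<Rightarrow> nat set" where
  "desc \<tau> v = \<Union>{w \<in> verts \<tau>. (w, v) \<in> (parent \<tau>)\<^sup>*}"

text \<open>Points of $\mathbb{R}^n$ are functions on \<open>{1..n}\<close>, extended by \<^const>\<open>undefined\<close>.\<close>

definition arbor_polytope :: "nat \<Rightarrow> arbor \<Rightarrow> (nat \<Rightarrow> real) set" where
  "arbor_polytope n \<tau> =
     {x \<in> {1..n} \<rightarrow>\<^sub>E UNIV. (\<forall>i\<in>{1..n}. 0 \<le> x i) \<and>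
        (\<forall>v\<in>verts \<tau>. (\<Sum>i\<in>desc \<tau> v. x i) \<le> real (card (desc \<tau> v)))}"

definition lattice_points :: "nat \<Rightarrow> (nat \<Rightarrow> real) set \<Rightarrow> (nat \<Rightarrow> real) set" where
  "lattice_points n Q = Q \<inter> ({1..n} \<rightarrow>\<^sub>E \<int>)"

definition h_poly :: "nat \<Rightarrow> arbor \<Rightarrow> real poly" where
  "h_poly n \<tau> =
     (\<Sum>x\<in>lattice_points n (arbor_polytope n \<tau>). monom 1 (card {i\<in>{1..n}. x i \<noteq> 0}))"

definition gamma_expansion :: "nat \<Rightarrow> arbor \<Rightarrow> (nat \<Rightarrow> real) \<Rightarrow> bool" where
  "gamma_expansion n \<tau> g \<longleftrightarrow>
     h_poly n \<tau> = (\<Sum>j=0..n div 2. smult (g j) (monom 1 j * [:1, 1:] ^ (n - 2 * j)))"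

definition gamma_positive :: "nat \<Rightarrow> arbor \<Rightarrow> bool" where
  "gamma_positive n \<tau> \<longleftrightarrow>
     (\<exists>g. gamma_expansion n \<tau> g \<and> (\<forall>j\<in>{0..n div 2}. 0 \<le> g j))"

definition octopus_leaves :: "nat \<Rightarrow> nat \<Rightarrow> nat set set" where
  "octopus_leaves k1 k2 =
     {{i} | i. i \<in> {1..k1}} \<union> {{k1 + 2 * l + 1, k1 + 2 * l + 2} | l. l < k2}"

definition lopsided_octopus :: "nat \<Rightarrow> nat \<Rightarrow> nat \<Rightarrow> arbor" where
  "lopsided_octopus n k1 k2 =
     (let r = {k1 + 2 * k2 + 1..n}; L = octopus_leaves k1 k2
      in \<lparr>verts = insert r L, root_vertex = r, parent = L \<times> {r}\<rparr>)"

text \<open>Binomial coefficients with a possibly negative lower index. Integer arguments avoid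
  the truncated subtraction of natural numbers, under which \<open>m choose (j - i)\<close>
  would be 1 instead of 0 for \<open>i > j\<close>.\<close>

definition binom :: "int \<Rightarrow> int \<Rightarrow> real" where
  "binom a b = (if b < 0 then 0 else real_of_int a gchoose nat b)"

text \<open>Consistency checks: for every arbor the sum in \<^const>\<open>h_poly\<close> is finite (a sum over an
  infinite set would be 0 by convention), the lopsided octopus is an arbor, and its lattice
  points have the expected explicit description.\<close>

lemma finite_lattice_points:
  assumes "is_arbor n \<tau>"
  shows "finite (lattice_points n (arbor_polytope n \<tau>))"
proof -
  have d: "desc \<tau> (root_vertex \<tau>) = {1..n}"
  proof -
    have "{w \<in> verts \<tau>. (w, root_vertex \<tau>) \<in> (parent \<tau>)\<^sup>*} = verts \<tau>"
      using assms by (auto simp: is_arbor_def)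
    then show ?thesis using assms by (simp add: is_arbor_def desc_def)
  qed
  have r: "root_vertex \<tau> \<in> verts \<tau>" using assms by (simp add: is_arbor_def)
  have "lattice_points n (arbor_polytope n \<tau>) \<subseteq> {1..n} \<rightarrow>\<^sub>E (real ` {0..n})"
  proof
    fix x assume x: "x \<in> lattice_points n (arbor_polytope n \<tau>)"
    have nn: "0 \<le> x i" and Z: "x i \<in> \<int>" if "i \<in> {1..n}" for i
      using x that by (auto simp: lattice_points_def arbor_polytope_def PiE_iff)
    have s: "(\<Sum>i\<in>{1..n}. x i) \<le> real n"
      using x r d unfolding lattice_points_def arbor_polytope_def by fastforce
    have "x i \<in> real ` {0..n}" if i: "i \<in> {1..n}" for i
    proof -
      have "x i \<le> (\<Sum>i\<in>{1..n}. x i)"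
        by (rule member_le_sum) (use i nn in auto)
      with s have le: "x i \<le> real n" by simp
      have "x i \<in> \<nat>" using nn[OF i] Z[OF i] by (simp add: Nats_altdef2)
      then obtain m where "x i = real m" by (auto elim: Nats_cases)
      with le show ?thesis by auto
    qed
    with x show "x \<in> {1..n} \<rightarrow>\<^sub>E (real ` {0..n})"
      by (auto simp: lattice_points_def arbor_polytope_def PiE_iff)
  qed
  then show ?thesis by (rule finite_subset) (auto intro: finite_PiE)
qed

lemma Union_octopus_leaves: "\<Union>(octopus_leaves k1 k2) = {1..k1 + 2 * k2}"
proof (intro equalityI subsetI)
  fix i assume "i \<in> {1..k1 + 2 * k2}"
  show "i \<in> \<Union>(octopus_leaves k1 k2)"
  proof (cases "i \<le> k1")
    case True
    then show ?thesis using \<open>i \<in> _\<close> by (auto simp: octopus_leaves_def)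
  next
    case False
    define l where "l = (i - k1 - 1) div 2"
    have "i \<in> {k1 + 2 * l + 1, k1 + 2 * l + 2}" "l < k2"
      using False \<open>i \<in> _\<close> by (auto simp: l_def)
    then show ?thesis unfolding octopus_leaves_def by blast
  qed
qed (auto simp: octopus_leaves_def)

lemma disjoint_octopus: "disjoint (insert {k1 + 2 * k2 + 1..n} (octopus_leaves k1 k2))"
proof -
  define c where "c i = (if i \<le> k1 then {i} else {j. (j - k1 - 1) div 2 = (i - k1 - 1) div 2 \<and> k1 < j})" for i
  have c: "b = c x" if "b \<in> octopus_leaves k1 k2" "x \<in> b" for b x
  proof -
    from that consider i where "b = {i}" "i \<le> k1"
      | l where "b = {k1 + 2 * l + 1, k1 + 2 * l + 2}"
      unfolding octopus_leaves_def by auto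
    then show ?thesis
    proof cases
      case 1
      with that show ?thesis by (simp add: c_def)
    next
      case (2 l)
      have "{j. (j - k1 - 1) div 2 = l \<and> k1 < j} = {k1 + 2 * l + 1, k1 + 2 * l + 2}"
        by (auto; linarith)
      moreover have "x = k1 + 2 * l + 1 \<or> x = k1 + 2 * l + 2" using that 2 by simp
      then have "\<not> x \<le> k1" "(x - k1 - 1) div 2 = l" by auto
      ultimately show ?thesis using 2 by (simp add: c_def)
    qed
  qed
  have "a \<inter> b = {}" if "a \<in> octopus_leaves k1 k2" "b \<in> octopus_leaves k1 k2" "a \<noteq> b" for a b
    using c that by (metis disjoint_iff)
  moreover have "{k1 + 2 * k2 + 1..n} \<inter> b = {}" if "b \<in> octopus_leaves k1 k2" for b
  proof -
    have "b \<subseteq> {1..k1 + 2 * k2}" using that Union_octopus_leaves by blast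
    then show ?thesis by fastforce
  qed
  ultimately show ?thesis unfolding disjoint_def by blast
qed

lemma octopus_root_notin_leaves: "{k1 + 2 * k2 + 1..n} \<notin> octopus_leaves k1 k2"
proof
  assume a: "{k1 + 2 * k2 + 1..n} \<in> octopus_leaves k1 k2"
  then have "{k1 + 2 * k2 + 1..n} \<subseteq> {1..k1 + 2 * k2}"
    using Union_octopus_leaves by blast
  then have "{k1 + 2 * k2 + 1..n} = {}" by fastforce
  with a show False by (auto simp: octopus_leaves_def)
qed

lemma octopus_rtrancl: 
  assumes "r \<notin> L" shows "(L \<times> {r})\<^sup>* = Id \<union> L \<times> {r}"
proof (intro equalityI subrelI)
  fix x y assume "(x, y) \<in> (L \<times> {r})\<^sup>*"
  then show "(x, y) \<in> Id \<union> L \<times> {r}"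
    by induction (use assms in auto)
qed auto

lemma is_arbor_lopsided_octopus:
  assumes "k1 + 2 * k2 \<le> n"
  shows "is_arbor n (lopsided_octopus n k1 k2)"
proof -
  have "{} \<notin> octopus_leaves k1 k2" by (auto simp: octopus_leaves_def)
  moreover have "{k1 + 2 * k2 + 1..n} \<union> {1..k1 + 2 * k2} = {1..n}" using assms by auto
  ultimately show ?thesis
    using octopus_root_notin_leaves[of k1 k2 n] disjoint_octopus[of k1 k2 n]
    by (auto simp: is_arbor_def lopsided_octopus_def Let_def Union_octopus_leaves
        octopus_rtrancl)
qed

lemma lattice_points_lopsided_octopus:
  assumes "k1 + 2 * k2 \<le> n"
  shows "lattice_points n (arbor_polytope n (lopsided_octopus n k1 k2)) =
    {x \<in> {1..n} \<rightarrow>\<^sub>E \<int>. (\<forall>i\<in>{1..n}. 0 \<le> x i) \<and> (\<forall>i\<in>{1..k1}. x i \<le> 1) \<and>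
       (\<forall>l<k2. x (k1 + 2 * l + 1) + x (k1 + 2 * l + 2) \<le> 2) \<and> (\<Sum>i=1..n. x i) \<le> real n}"
proof -
  let ?r = "{k1 + 2 * k2 + 1..n}" and ?L = "octopus_leaves k1 k2"
  let ?t = "lopsided_octopus n k1 k2"
  have v: "verts ?t = insert ?r ?L" and p: "parent ?t = ?L \<times> {?r}"
    by (simp_all add: lopsided_octopus_def Let_def)
  have rt: "(w, u) \<in> (parent ?t)\<^sup>* \<longleftrightarrow> w = u \<or> w \<in> ?L \<and> u = ?r" for w u
    unfolding p octopus_rtrancl[OF octopus_root_notin_leaves] by blast
  have "{w \<in> verts ?t. (w, ?r) \<in> (parent ?t)\<^sup>*} = insert ?r ?L"
    unfolding v rt by blast
  then have "desc ?t ?r = ?r \<union> {1..k1 + 2 * k2}"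
    unfolding desc_def by (simp add: Union_octopus_leaves)
  moreover have "?r \<union> {1..k1 + 2 * k2} = {1..n}" using assms by auto
  ultimately have r: "desc ?t ?r = {1..n}" by simp
  have l: "desc ?t u = u" if "u \<in> ?L" for u
  proof -
    have "u \<noteq> ?r" using octopus_root_notin_leaves that by blast
    then have "{w \<in> verts ?t. (w, u) \<in> (parent ?t)\<^sup>*} = {u}"
      unfolding v rt using that by blast
    then show ?thesis by (simp add: desc_def)
  qed
  have leaves: "(\<forall>u\<in>?L. P u) \<longleftrightarrow> (\<forall>i\<in>{1..k1}. P {i}) \<and>
      (\<forall>m<k2. P {k1 + 2 * m + 1, k1 + 2 * m + 2})" for P
    unfolding octopus_leaves_def by blast
  have root: "(\<forall>u\<in>verts ?t. P (desc ?t u)) \<longleftrightarrow> P {1..n} \<and> (\<forall>u\<in>?L. P u)" for P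
    unfolding v using r l by simp
  have main: "(\<forall>u\<in>verts ?t. (\<Sum>i\<in>desc ?t u. x i) \<le> real (card (desc ?t u))) \<longleftrightarrow>
      (\<Sum>i=1..n. x i) \<le> real n \<and> (\<forall>i\<in>{1..k1}. x i \<le> 1) \<and>
      (\<forall>l<k2. x (k1 + 2 * l + 1) + x (k1 + 2 * l + 2) \<le> 2)" for x :: "nat \<Rightarrow> real"
    unfolding root[of "\<lambda>u. (\<Sum>i\<in>u. x i) \<le> real (card u)"] leaves by simp
  show ?thesis
    unfolding lattice_points_def arbor_polytope_def main
    by (rule set_eqI) (simp only: Int_iff mem_Collect_eq PiE_iff UNIV_I simp_thms, blast)
qed

end

theory Submission
  imports Defs
begin

text \<open>
  Write $k = k_1 + 2k_2$, $m = n - k$, $s = 1 + t$, and let $W(N)$ be the sum of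
  $t^{|\mathrm{supp}\, x|}$ over the points that satisfy the leaf inequalities and have
  coordinate sum at most $N$, so that $h(\tau, t) = W(n)$. The proof is a computation of
  coefficients in an auxiliary variable $y$.

  With $m$ unconstrained coordinates and no leaves, one chooses the $b$ nonzero coordinates in
  $\binom m b$ ways and their values in $\binom N b$ ways, so
  $W(N) = \sum_b \binom m b \binom N b t^b = [y^N]\, (1 + ty)^m (1 + y)^N$.
  Attaching a leaf turns $W(N)$ into a combination of values of $W$ with smaller cap:
  a singleton gives $W(N) + t W(N-1)$, and a doubleton gives
  $W(N) + 2t W(N-1) + (2t + t^2) W(N-2)$. As long as $N$ is at least the total size of
  the leaves, each leaf can borrow its share of the factor $(1+y)^N$: a singleton replaces
  $1 + y$ by $1 + sy$, and a doubleton replaces $(1 + y)^2$ by $(1 + sy)^2 + 2ty^2$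
  (lemmas \<open>diagonal_form_singleton\<close>, \<open>diagonal_form_doubleton\<close>). At $N = n$ the exponent of
  $1 + y$ that is left over is exactly $m$, whence
  \[ h(\tau,t) = [y^n]\, \bigl((1+sy)^2 + 2ty^2\bigr)^{k_2} (1 + sy)^{k_1}
       \bigl((1+ty)(1+y)\bigr)^m . \]
  Now $(1+ty)(1+y) = (1+sy) + ty^2$, so every factor is a power of $1 + sy$ plus a
  multiple of $ty^2$. Choosing the second summand in $i$ of the doubletons and in $l$ of the
  free factors contributes
  $2^i \binom{k_2}{i} \binom m l \, t^{j} [y^{n-2j}] (1+sy)^{n-j-i}$ with $j = i + l$,
  and that last coefficient is $\binom{n-j-i}{j-i} (1+t)^{n-2j}$
  (lemma \<open>coeff_octopus\<close>). The $\gamma$-expansion can be read off, its coefficients are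
  visibly nonnegative, and \<open>gamma_coefficients_unique\<close> says that there are no others.
\<close>

section \<open>Support polynomials of points with bounded coordinate sum\<close>

definition support_sum :: "'a::comm_ring_1 \<Rightarrow> 'i set \<Rightarrow> (('i \<Rightarrow> nat) \<Rightarrow> bool) \<Rightarrow> nat \<Rightarrow> 'a" where
  "support_sum t I C N =
     (\<Sum>x\<in>{x \<in> I \<rightarrow>\<^sub>E UNIV. C x \<and> sum x I \<le> N}. t ^ card {i\<in>I. x i \<noteq> 0})"

lemma finite_capped_functions:
  fixes I :: "'i set"
  assumes "finite I"
  shows "finite {x \<in> I \<rightarrow>\<^sub>E (UNIV :: nat set). C x \<and> sum x I \<le> N}"
proof (rule finite_subset)
  show "{x \<in> I \<rightarrow>\<^sub>E (UNIV :: nat set). C x \<and> sum x I \<le> N} \<subseteq> I \<rightarrow>\<^sub>E {..N}"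
  proof
    fix x :: "'i \<Rightarrow> nat" assume "x \<in> {x \<in> I \<rightarrow>\<^sub>E UNIV. C x \<and> sum x I \<le> N}"
    then have x: "x \<in> I \<rightarrow>\<^sub>E UNIV" "sum x I \<le> N" by auto
    have "x i \<le> N" if "i \<in> I" for i
      using member_le_sum[OF that, of x] assms x(2) by auto
    with x(1) show "x \<in> I \<rightarrow>\<^sub>E {..N}" by (auto simp: PiE_iff)
  qed
  show "finite (I \<rightarrow>\<^sub>E {..N})" using assms by (simp add: finite_PiE)
qed

lemma support_sum_conj_const:
  "support_sum t I (\<lambda>x. C x \<and> b) N = (if b then support_sum t I C N else 0)"
  by (simp add: support_sum_def)

text \<open>Splitting off one coordinate lowers the cap by its value; all recursions for attaching
  coordinates come from this one.\<close>

lemma support_sum_insert: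
  assumes "finite I" "a \<notin> I"
  shows "support_sum t (insert a I) C N =
    (\<Sum>v\<le>N. t ^ of_bool (v \<noteq> 0) * support_sum t I (\<lambda>x. C (x(a := v))) (N - v))"
proof -
  define X where "X v = {x \<in> I \<rightarrow>\<^sub>E UNIV. C (x(a := v)) \<and> sum x I \<le> N - v}" for v :: nat
  have fin: "finite (X v)" for v
    unfolding X_def by (rule finite_capped_functions[OF assms(1)])
  have sum_upd: "sum (x(a := v)) I = sum x I" for x :: "'a \<Rightarrow> nat" and v
    by (rule sum.cong) (use assms in auto)
  have supp: "card {i \<in> insert a I. (x(a := v)) i \<noteq> 0} =
      of_bool (v \<noteq> 0) + card {i \<in> I. x i \<noteq> 0}" for x :: "'a \<Rightarrow> nat" and v
  proof -
    have "{i \<in> insert a I. (x(a := v)) i \<noteq> 0} =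
        (if v \<noteq> 0 then insert a {i \<in> I. x i \<noteq> 0} else {i \<in> I. x i \<noteq> 0})"
      using assms by auto
    then show ?thesis using assms by auto
  qed
  have upd: "(restrict x I)(a := x a) = x" if "x \<in> insert a I \<rightarrow>\<^sub>E UNIV" for x :: "'a \<Rightarrow> nat"
    using that by (fastforce simp: PiE_iff extensional_def)
  have "support_sum t (insert a I) C N =
      (\<Sum>(v, x)\<in>Sigma {..N} X. t ^ of_bool (v \<noteq> 0) * t ^ card {i\<in>I. x i \<noteq> 0})"
    unfolding support_sum_def
  proof (rule sum.reindex_bij_witness[where
        i = "\<lambda>(v, x). x(a := v)" and j = "\<lambda>x. (x a, restrict x I)"], goal_cases)
    case (1 x)
    then show ?case using upd by auto
  next
    case (2 x)
    have "sum (restrict x I) I = sum x I" by (rule sum.cong) auto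
    with 2 show ?case using upd[of x] assms by (auto simp: X_def)
  next
    case (3 p)
    then show ?case using assms
      by (auto simp: X_def PiE_iff extensional_def restrict_def fun_eq_iff split: prod.splits)
  next
    case (4 p)
    obtain v x where p: "p = (v, x)" by force
    show ?case using 4 assms sum_upd[of x v]
      unfolding p by (auto simp: X_def PiE_iff extensional_def)
  next
    case (5 x)
    then have "card {i \<in> insert a I. x i \<noteq> 0} =
        of_bool (x a \<noteq> 0) + card {i \<in> I. restrict x I i \<noteq> 0}"
      using supp[of "restrict x I" "x a"] upd[of x] by simp
    then show ?case by (simp add: power_add)
  qed
  also have "\<dots> = (\<Sum>v\<le>N. \<Sum>x\<in>X v. t ^ of_bool (v \<noteq> 0) * t ^ card {i\<in>I. x i \<noteq> 0})"
    by (rule sum.Sigma[symmetric]) (use fin in auto)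
  also have "\<dots> = (\<Sum>v\<le>N. t ^ of_bool (v \<noteq> 0) * support_sum t I (\<lambda>x. C (x(a := v))) (N - v))"
    unfolding support_sum_def X_def sum_distrib_left ..
  finally show ?thesis .
qed

lemma coeff_linear_factor:
  fixes P :: "'a::comm_ring_1 poly"
  shows "coeff ([:a, b:] * P) (Suc N) = a * coeff P (Suc N) + b * coeff P N"
  by simp

text \<open>Pascal's rule in disguise: the factor $1 + y$ splits off the last term of the sum. The
  sum is the one that appears when a free coordinate runs through its positive values.\<close>

lemma sum_diagonal_coeff:
  fixes P :: "'a::comm_ring_1 poly"
  shows "coeff (P * [:1, 1:] ^ Suc N) N = (\<Sum>v\<le>N. coeff (P * [:1, 1:] ^ v) v)"
proof (induction N)
  case 0
  then show ?case by (simp add: coeff_mult)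
next
  case (Suc N)
  have "P * [:1, 1:] ^ Suc (Suc N) = [:1, 1:] * (P * [:1, 1:] ^ Suc N)"
    by (simp add: algebra_simps)
  then have "coeff (P * [:1, 1:] ^ Suc (Suc N)) (Suc N) =
      coeff (P * [:1, 1:] ^ Suc N) (Suc N) + coeff (P * [:1, 1:] ^ Suc N) N"
    by (simp only: coeff_linear_factor) simp
  with Suc.IH show ?case by simp
qed

text \<open>The right-hand side is $\sum_b \binom{|J|}{b} \binom N b t^b$: choose the $b$ nonzero
  coordinates, then $b$ positive values of sum at most $N$, that is, $b$ distinct partial sums
  in $\{1,\dots,N\}$.\<close>

lemma support_sum_free:
  fixes t :: "'a::comm_ring_1"
  assumes "finite J"
  shows "support_sum t J (\<lambda>_. True) N = coeff ([:1, t:] ^ card J * [:1, 1:] ^ N) N"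
  using assms
proof (induction J arbitrary: N)
  case empty
  have "coeff ([:1, 1::'a:] ^ N) N = 1"
    by (simp add: coeff_linear_power)
  then show ?case by (simp add: support_sum_def)
next
  case (insert a J)
  define P where "P = [:1, t:] ^ card J"
  have "support_sum t (insert a J) (\<lambda>_. True) N =
      (\<Sum>v\<le>N. t ^ of_bool (v \<noteq> 0) * coeff (P * [:1, 1:] ^ (N - v)) (N - v))"
    using insert by (simp add: support_sum_insert P_def)
  also have "\<dots> = coeff ([:1, t:] * (P * [:1, 1:] ^ N)) N"
  proof (cases N)
    case 0
    then show ?thesis by (simp add: coeff_mult)
  next
    case (Suc M)
    have "(\<Sum>v\<le>N. t ^ of_bool (v \<noteq> 0) * coeff (P * [:1, 1:] ^ (N - v)) (N - v)) =
       coeff (P * [:1, 1:] ^ N) N + t * (\<Sum>v\<le>M. coeff (P * [:1, 1:] ^ (M - v)) (M - v))"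
      unfolding Suc sum.atMost_Suc_shift by (simp add: sum_distrib_left)
    also have "(\<Sum>v\<le>M. coeff (P * [:1, 1:] ^ (M - v)) (M - v)) = coeff (P * [:1, 1:] ^ N) M"
      unfolding Suc sum_diagonal_coeff
      by (rule sum.reindex_bij_witness[where i = "\<lambda>v. M - v" and j = "\<lambda>v. M - v"]) auto
    finally show ?thesis
      unfolding Suc by (simp only: coeff_linear_factor) simp
  qed
  also have "[:1, t:] * (P * [:1, 1:] ^ N) = [:1, t:] ^ card (insert a J) * [:1, 1:] ^ N"
    using insert by (simp add: P_def algebra_simps)
  finally show ?case .
qed

section \<open>Attaching leaves\<close>

text \<open>The form in which the attached coordinates are absorbed into the generating polynomial:
  \<open>p\<close> is the total size of the leaves, each unit of which has used up one factor
  $1 + y$. The bound $N \geq p$ keeps the exponent of $1 + y$ nonnegative.\<close>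

definition diagonal_form ::
  "'a::comm_ring_1 \<Rightarrow> 'i set \<Rightarrow> (('i \<Rightarrow> nat) \<Rightarrow> bool) \<Rightarrow> nat \<Rightarrow> 'a poly \<Rightarrow> bool" where
  "diagonal_form t I C p Q \<longleftrightarrow>
     (\<forall>N\<ge>p. support_sum t I C N = coeff (Q * [:1, 1:] ^ (N - p)) N)"

text \<open>A singleton takes the value $0$ or $1$, which multiplies the generating polynomial by
  $(1 + y) + ty = 1 + (1+t)y$ in place of $1 + y$.\<close>

lemma diagonal_form_singleton:
  assumes "finite I" "a \<notin> I" and indep: "\<And>x v. C (x(a := v)) = C x"
    and form: "diagonal_form t I C p Q"
  shows "diagonal_form t (insert a I) (\<lambda>x. C x \<and> x a \<le> 1) (Suc p) ([:1, 1 + t:] * Q)"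
  unfolding diagonal_form_def
proof (intro allI impI)
  fix N assume "Suc p \<le> N"
  then obtain M where N: "N = Suc M" and M: "p \<le> M" by (cases N) auto
  define f where "f = support_sum t I C"
  define R where "R = Q * [:1, 1:] ^ (M - p)"
  have "support_sum t (insert a I) (\<lambda>x. C x \<and> x a \<le> 1) N =
      (\<Sum>v\<le>N. t ^ of_bool (v \<noteq> 0) * (if v \<le> 1 then f (N - v) else 0))"
    using assms by (simp add: support_sum_insert support_sum_conj_const f_def cong: if_cong)
  also have "\<dots> = (\<Sum>v\<in>{0, 1}. t ^ of_bool (v \<noteq> 0) * f (N - v))"
    by (rule sum.mono_neutral_cong_right) (auto simp: N)
  also have "\<dots> = f (Suc M) + t * f M" by (simp add: N)
  also have "\<dots> = coeff ([:1, 1:] * R) (Suc M) + t * coeff R M"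
    using M form by (simp add: diagonal_form_def f_def R_def Suc_diff_le algebra_simps)
  also have "\<dots> = coeff ([:1, 1 + t:] * R) (Suc M)"
    by (simp only: coeff_linear_factor) (simp add: algebra_simps)
  finally show "support_sum t (insert a I) (\<lambda>x. C x \<and> x a \<le> 1) N =
      coeff ([:1, 1 + t:] * Q * [:1, 1:] ^ (N - Suc p)) N"
    by (simp only: N R_def diff_Suc_Suc mult.assoc)
qed

text \<open>The six pairs $(u, v)$ with $u + v \leq 2$ contribute
  $(1+y)^2 + 2ty(1+y) + (2t+t^2)y^2$ in place of $(1+y)^2$. Its form as a square plus
  $2ty^2$ is what makes the factor compatible with the singletons.\<close>

lemma diagonal_form_doubleton:
  assumes "finite I" "a \<notin> I" "b \<notin> I" "a \<noteq> b"
    and indep: "\<And>x v. C (x(a := v)) = C x" "\<And>x v. C (x(b := v)) = C x"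
    and form: "diagonal_form t I C p Q"
  shows "diagonal_form t (insert a (insert b I)) (\<lambda>x. C x \<and> x a + x b \<le> 2) (p + 2)
    (([:1, 1 + t:]\<^sup>2 + [:0, 0, 2 * t:]) * Q)"
  unfolding diagonal_form_def
proof (intro allI impI)
  fix N assume "p + 2 \<le> N"
  then obtain M where N: "N = Suc (Suc M)" and M: "p \<le> M"
    by (metis add_2_eq_Suc' add_le_cancel_right le_Suc_ex add.assoc add.commute le_add1)
  define f where "f = support_sum t I C"
  define R where "R = Q * [:1, 1:] ^ (M - p)"
  define w where "w u v = t ^ of_bool (u \<noteq> 0) * (t ^ of_bool (v \<noteq> 0) * f (N - u - v))"
    for u v :: nat
  have "support_sum t (insert a (insert b I)) (\<lambda>x. C x \<and> x a + x b \<le> 2) N =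
      (\<Sum>u\<le>N. \<Sum>v\<le>N - u. if u + v \<le> 2 then w u v else 0)"
    using assms
    by (simp add: support_sum_insert support_sum_conj_const f_def w_def sum_distrib_left
        if_distrib cong: if_cong)
  also have "\<dots> = (\<Sum>u\<le>2. \<Sum>v\<le>2 - u. w u v)"
    by (intro sum.mono_neutral_cong_right) (auto simp: N)
  also have "\<dots> = f (Suc (Suc M)) + 2 * t * f (Suc M) + (2 * t + t\<^sup>2) * f M"
    by (simp add: numeral_2_eq_2 w_def N algebra_simps)
  also have "f (Suc (Suc M)) = coeff ([:1, 1:]\<^sup>2 * R) (Suc (Suc M))"
    using M form by (simp add: diagonal_form_def f_def R_def Suc_diff_le power2_eq_square mult_ac
        del: mult_pCons_left mult_pCons_right)
  also have "f (Suc M) = coeff ([:1, 1:] * R) (Suc M)"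
    using M form by (simp add: diagonal_form_def f_def R_def Suc_diff_le mult_ac
        del: mult_pCons_left mult_pCons_right)
  also have "f M = coeff R M"
    using M form by (simp add: diagonal_form_def f_def R_def)
  also have "coeff ([:1, 1:]\<^sup>2 * R) (Suc (Suc M)) + 2 * t * coeff ([:1, 1:] * R) (Suc M)
      + (2 * t + t\<^sup>2) * coeff R M = coeff (([:1, 1 + t:]\<^sup>2 + [:0, 0, 2 * t:]) * R) (Suc (Suc M))"
    by (simp add: power2_eq_square algebra_simps)
  finally show "support_sum t (insert a (insert b I)) (\<lambda>x. C x \<and> x a + x b \<le> 2) N =
      coeff (([:1, 1 + t:]\<^sup>2 + [:0, 0, 2 * t:]) * Q * [:1, 1:] ^ (N - (p + 2))) N"
    by (simp only: N R_def mult.assoc) simp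
qed

lemma diagonal_form_singletons:
  assumes "finite J" "J \<inter> {1..k1} = {}"
  shows "diagonal_form t ({1..k1} \<union> J) (\<lambda>x. \<forall>i\<in>{1..k1}. x i \<le> 1) k1
    ([:1, 1 + t:] ^ k1 * [:1, t:] ^ card J)"
  using assms(2)
proof (induction k1)
  case 0
  then show ?case
    using assms(1) by (simp add: diagonal_form_def support_sum_free)
next
  case (Suc k1)
  have "diagonal_form t (insert (Suc k1) ({1..k1} \<union> J))
      (\<lambda>x. (\<forall>i\<in>{1..k1}. x i \<le> 1) \<and> x (Suc k1) \<le> 1) (Suc k1)
      ([:1, 1 + t:] * ([:1, 1 + t:] ^ k1 * [:1, t:] ^ card J))"
    by (rule diagonal_form_singleton[OF _ _ _ Suc.IH]) (use Suc.prems assms(1) in \<open>auto simp: disjoint_iff\<close>)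
  moreover have "insert (Suc k1) ({1..k1} \<union> J) = {1..Suc k1} \<union> J"
    by auto
  ultimately show ?case
    by (simp add: atLeastAtMostSuc_conv conj_commute mult.assoc
        del: mult_pCons_left mult_pCons_right)
qed

lemma diagonal_form_octopus:
  assumes "finite J" "J \<inter> {1..k1 + 2 * k2} = {}"
  shows "diagonal_form t ({1..k1 + 2 * k2} \<union> J)
    (\<lambda>x. (\<forall>i\<in>{1..k1}. x i \<le> 1) \<and> (\<forall>l<k2. x (k1 + 2 * l + 1) + x (k1 + 2 * l + 2) \<le> 2))
    (k1 + 2 * k2)
    (([:1, 1 + t:]\<^sup>2 + [:0, 0, 2 * t:]) ^ k2 * ([:1, 1 + t:] ^ k1 * [:1, t:] ^ card J))"
  using assms(2)
proof (induction k2)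
  case 0
  then show ?case using diagonal_form_singletons[OF assms(1), of k1 t] by simp
next
  case (Suc k2)
  let ?C = "\<lambda>k2 x. (\<forall>i\<in>{1..k1}. x i \<le> 1) \<and>
    (\<forall>l<k2. x (k1 + 2 * l + 1) + x (k1 + 2 * l + 2) \<le> (2::nat))"
  let ?a = "k1 + 2 * k2 + 1" and ?b = "k1 + 2 * k2 + 2"
  let ?D = "[:1, 1 + t:]\<^sup>2 + [:0, 0, 2 * t:]"
  let ?Q = "[:1, 1 + t:] ^ k1 * [:1, t:] ^ card J"
  have "diagonal_form t (insert ?a (insert ?b ({1..k1 + 2 * k2} \<union> J)))
      (\<lambda>x. ?C k2 x \<and> x ?a + x ?b \<le> 2) (k1 + 2 * k2 + 2) (?D * (?D ^ k2 * ?Q))"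
    by (rule diagonal_form_doubleton[OF _ _ _ _ _ _ Suc.IH]) (use Suc.prems assms(1) in \<open>auto simp: disjoint_iff\<close>)
  moreover have "insert ?a (insert ?b ({1..k1 + 2 * k2} \<union> J)) = {1..k1 + 2 * Suc k2} \<union> J"
    by auto
  moreover have "(\<lambda>x. ?C k2 x \<and> x ?a + x ?b \<le> 2) = ?C (Suc k2)"
    by (auto simp: less_Suc_eq fun_eq_iff)
  moreover have "?D * (?D ^ k2 * ?Q) = ?D ^ Suc k2 * ?Q"
    by (simp only: power_Suc mult.assoc)
  moreover have "k1 + 2 * k2 + 2 = k1 + 2 * Suc k2" by simp
  ultimately show ?case by metis
qed

section \<open>Uniqueness of the $\gamma$-coefficients\<close>

text \<open>The $j$-th basis polynomial $t^j(1+t)^{n-2j}$ has lowest term $t^j$, so the basis is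
  triangular with respect to the powers of $t$.\<close>

lemma gamma_coefficients_unique:
  assumes "gamma_expansion n \<tau> g" "gamma_expansion n \<tau> g'" "j \<le> n div 2"
  shows "g j = g' j"
  using assms(3)
proof (induction j rule: less_induct)
  case (less j)
  have lead: "coeff ([:1, 1::real:] ^ r) 0 = 1" for r
    by (simp add: coeff_0_power)
  define b where "b i = coeff (monom 1 i * [:1, 1::real:] ^ (n - 2 * i)) j" for i
  have b: "b j = 1" "i > j \<Longrightarrow> b i = 0" for i
    by (simp_all add: b_def coeff_monom_mult lead)
  have "(\<Sum>i=0..n div 2. g i * b i) = (\<Sum>i=0..n div 2. g' i * b i)"
    using arg_cong[of _ _ "\<lambda>p. coeff p j", OF trans[OF
        assms(1)[unfolded gamma_expansion_def, symmetric] assms(2)[unfolded gamma_expansion_def]]]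
    by (simp only: coeff_sum coeff_smult b_def)
  moreover have "(\<Sum>i=0..n div 2. f i * b i) = f j + (\<Sum>i<j. f i * b i)" for f
  proof -
    have "(\<Sum>i=0..n div 2. f i * b i) = (\<Sum>i\<in>insert j {..<j}. f i * b i)"
      by (rule sum.mono_neutral_right) (use less.prems b in \<open>auto simp: not_less_iff_gr_or_eq\<close>)
    then show ?thesis by (simp add: b)
  qed
  moreover have "(\<Sum>i<j. g i * b i) = (\<Sum>i<j. g' i * b i)"
    by (rule sum.cong) (use less in auto)
  ultimately show ?case by simp
qed

section \<open>The expansion for the lopsided octopus\<close>

lemma h_poly_lopsided_octopus:
  assumes "k1 + 2 * k2 \<le> n"
  shows "h_poly n (lopsided_octopus n k1 k2) = support_sum (monom 1 1) {1..n}
    (\<lambda>x. (\<forall>i\<in>{1..k1}. x i \<le> 1) \<and> (\<forall>l<k2. x (k1 + 2 * l + 1) + x (k1 + 2 * l + 2) \<le> 2)) n"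
  unfolding h_poly_def support_sum_def lattice_points_lopsided_octopus[OF assms]
proof (rule sum.reindex_bij_witness[where
      i = "\<lambda>x. restrict (\<lambda>i. real (x i)) {1..n}" and j = "\<lambda>x. restrict (\<lambda>i. nat \<lfloor>x i\<rfloor>) {1..n}"],
    goal_cases)
  case (1 x)
  then have "real (nat \<lfloor>x i\<rfloor>) = x i" if "i \<in> {1..n}" for i
    using that by (auto simp: PiE_iff elim!: Ints_cases)
  with 1 show ?case by (fastforce simp: PiE_iff extensional_def)
next
  case (2 x)
  then have r: "real (nat \<lfloor>x i\<rfloor>) = x i" if "i \<in> {1..n}" for i
    using that by (auto simp: PiE_iff elim!: Ints_cases)
  have "real (\<Sum>i=1..n. nat \<lfloor>x i\<rfloor>) = (\<Sum>i=1..n. x i)"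
    unfolding of_nat_sum by (rule sum.cong) (use r in auto)
  moreover have "(\<Sum>i=1..n. x i) \<le> real n" using 2 by auto
  ultimately have "(\<Sum>i=1..n. nat \<lfloor>x i\<rfloor>) \<le> n" by (metis of_nat_le_iff)
  moreover have "nat \<lfloor>x i\<rfloor> \<le> 1" if "i \<in> {1..k1}" for i
  proof -
    have "x i \<le> 1" using 2 that by auto
    then show ?thesis using r[of i] that assms by simp
  qed
  moreover have "nat \<lfloor>x (k1 + 2 * l + 1)\<rfloor> + nat \<lfloor>x (k1 + 2 * l + 2)\<rfloor> \<le> 2" if "l < k2" for l
  proof -
    have "x (k1 + 2 * l + 1) + x (k1 + 2 * l + 2) \<le> 2" using 2 that by auto
    then show ?thesis using r[of "k1 + 2 * l + 1"] r[of "k1 + 2 * l + 2"] that assms by simp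
  qed
  ultimately show ?case using assms by auto
next
  case (3 x)
  then show ?case by (auto simp: PiE_iff extensional_def fun_eq_iff)
next
  case (4 x)
  have "(\<Sum>i=1..n. real (x i)) = real (\<Sum>i=1..n. x i)" by simp
  also have "\<dots> \<le> real n" using 4 by (simp del: of_nat_sum)
  finally have "(\<Sum>i=1..n. real (x i)) \<le> real n" .
  moreover have "real (x (k1 + 2 * l + 1)) + real (x (k1 + 2 * l + 2)) \<le> 2" if "l < k2" for l
    using 4 that by (metis (mono_tags, lifting) mem_Collect_eq of_nat_add of_nat_le_iff of_nat_numeral)
  ultimately show ?case using 4 assms by auto
next
  case (5 x)
  then have r: "real (nat \<lfloor>x i\<rfloor>) = x i" if "i \<in> {1..n}" for i
    using that by (auto simp: PiE_iff elim!: Ints_cases)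
  have nz: "nat \<lfloor>x i\<rfloor> \<noteq> 0 \<longleftrightarrow> x i \<noteq> 0" if "i \<in> {1..n}" for i
    using r[OF that] by (metis of_nat_eq_0_iff)
  have "{i \<in> {1..n}. x i \<noteq> 0} = {i \<in> {1..n}. restrict (\<lambda>i. nat \<lfloor>x i\<rfloor>) {1..n} i \<noteq> 0}"
    by (intro Collect_cong conj_cong refl) (simp only: nz restrict_apply if_True)
  then show ?case by (simp add: monom_power)
qed

text \<open>A natural number, so that nonnegativity is immediate; the case distinction stands for the
  binomial coefficients with negative lower index. The parameter \<open>m\<close> is the size of the root.\<close>

definition octopus_gamma :: "nat \<Rightarrow> nat \<Rightarrow> nat \<Rightarrow> nat \<Rightarrow> nat" where
  "octopus_gamma n m k2 j = (\<Sum>i\<le>k2. if i \<le> j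
     then 2 ^ i * (k2 choose i) * (m choose (j - i)) * ((n - j - i) choose (j - i)) else 0)"

text \<open>The multiplication $(1+ty)(1+y) = (1+sy) + ty^2$ turns each of the three kinds of factors
  into a power of \<open>U\<close> $= 1 + sy$ plus a multiple of $ty^2$, so that after binomial expansion only
  coefficients of powers of \<open>U\<close> remain.\<close>

lemma coeff_octopus:
  fixes t :: "'a::comm_ring_1"
  assumes n: "n = m + k1 + 2 * k2"
  shows "coeff (([:1, 1 + t:]\<^sup>2 + [:0, 0, 2 * t:]) ^ k2 * ([:1, 1 + t:] ^ k1 * [:1, t:] ^ m)
      * [:1, 1:] ^ m) n =
    (\<Sum>j\<le>n div 2. of_nat (octopus_gamma n m k2 j) * t ^ j * (1 + t) ^ (n - 2 * j))"
proof -
  define U where "U = [:1, 1 + t:]"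
  define c where "c i l = (of_nat (k2 choose i) * of_nat (m choose l) * 2 ^ i * t ^ (i + l) :: 'a)"
    for i l
  define w where "w i l = (if 2 * (i + l) \<le> n
    then c i l * (of_nat ((n - 2 * i - l) choose l) * (1 + t) ^ (n - 2 * (i + l))) else 0)" for i l
  have mon: "[:0, 0, a:] = monom a 2" for a :: 'a
    by (simp add: numeral_2_eq_2 monom_Suc monom_0)
  have "[:1, t:] * [:1, 1:] = monom t 2 + U"
    by (simp add: U_def algebra_simps flip: mon)
  then have free: "[:1, t:] ^ m * [:1, 1:] ^ m = (\<Sum>l\<le>m. of_nat (m choose l) * monom t 2 ^ l * U ^ (m - l))"
    unfolding power_mult_distrib[symmetric] by (simp only: binomial_ring)
  have doubles: "(U\<^sup>2 + [:0, 0, 2 * t:]) ^ k2 =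
      (\<Sum>i\<le>k2. of_nat (k2 choose i) * monom (2 * t) 2 ^ i * (U\<^sup>2) ^ (k2 - i))"
    unfolding mon by (subst add.commute) (simp only: binomial_ring)
  have summand: "(of_nat (k2 choose i) * monom (2 * t) 2 ^ i * (U\<^sup>2) ^ (k2 - i)) *
      (U ^ k1 * (of_nat (m choose l) * monom t 2 ^ l * U ^ (m - l))) =
      monom (c i l) (2 * (i + l)) * U ^ (n - 2 * i - l)" if "i \<le> k2" "l \<le> m" for i l
  proof -
    have "n - 2 * i - l = 2 * (k2 - i) + (k1 + (m - l))" using that n by simp
    then have U: "U ^ (n - 2 * i - l) = (U\<^sup>2) ^ (k2 - i) * (U ^ k1 * U ^ (m - l))"
      by (simp only: power_add power_mult)
    have "monom (c i l) (2 * (i + l)) =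
        of_nat (k2 choose i) * of_nat (m choose l) * monom (2 * t) 2 ^ i * monom t 2 ^ l"
      by (simp add: c_def of_nat_poly monom_power mult_monom smult_monom power_mult_distrib
          power_add algebra_simps)
    then show ?thesis unfolding U by (simp only: mult_ac)
  qed
  have coeff_summand: "coeff (monom (c i l) (2 * (i + l)) * U ^ (n - 2 * i - l)) n = w i l" for i l
  proof (cases "2 * (i + l) \<le> n")
    case True
    define r where "r = n - 2 * i - l"
    have "l \<le> r" and d: "n - 2 * (i + l) = r - l" using True by (auto simp: r_def)
    have "coeff (monom (c i l) (2 * (i + l)) * U ^ r) n =
        c i l * (of_nat (r choose l) * (1 + t) ^ (r - l))"
      using True \<open>l \<le> r\<close> unfolding U_def
      by (simp add: coeff_monom_mult d coeff_linear_poly_power binomial_symmetric[of l r]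
          del: add_mult_distrib2 distrib_left_numeral)
    then show ?thesis using True by (simp only: w_def d r_def if_True)
  qed (simp add: coeff_monom_mult w_def)
  have "coeff ((U\<^sup>2 + [:0, 0, 2 * t:]) ^ k2 * (U ^ k1 * ([:1, t:] ^ m * [:1, 1:] ^ m))) n =
      (\<Sum>i\<le>k2. \<Sum>l\<le>m. w i l)"
    unfolding doubles free sum_distrib_left sum_distrib_right coeff_sum
    by (subst sum.swap, intro sum.cong refl) (simp only: atMost_iff summand coeff_summand)
  also have "\<dots> = (\<Sum>i\<le>k2. \<Sum>j\<le>n div 2. if i \<le> j then w i (j - i) else 0)"
  proof (rule sum.cong[OF refl])
    fix i
    \<comment> \<open>Substitute $j = i + l$. The terms with $j > n/2$ vanish because $y^{2j}$ does not
      divide $y^n$, those with $j - i > m$ because of $\binom{m}{j-i}$.\<close>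
    show "(\<Sum>l\<le>m. w i l) = (\<Sum>j\<le>n div 2. if i \<le> j then w i (j - i) else 0)"
      by (rule sum.reindex_bij_witness_not_neutral[where i = "\<lambda>j. j - i" and j = "\<lambda>l. i + l"
            and S' = "{l. l \<le> m \<and> n < 2 * (i + l)}"
            and T' = "{j. j \<le> n div 2 \<and> \<not> (i \<le> j \<and> j - i \<le> m)}"])
        (auto simp: w_def c_def binomial_eq_0)
  qed
  also have "\<dots> = (\<Sum>j\<le>n div 2. \<Sum>i\<le>k2. if i \<le> j then w i (j - i) else 0)"
    by (rule sum.swap)
  also have "\<dots> = (\<Sum>j\<le>n div 2. of_nat (octopus_gamma n m k2 j) * t ^ j * (1 + t) ^ (n - 2 * j))"
  proof (rule sum.cong[OF refl])
    fix j assume j: "j \<in> {..n div 2}"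
    have "(if i \<le> j then w i (j - i) else 0) =
        of_nat (if i \<le> j then 2 ^ i * (k2 choose i) * (m choose (j - i)) *
          ((n - j - i) choose (j - i)) else 0) * t ^ j * (1 + t) ^ (n - 2 * j)" for i
    proof (cases "i \<le> j")
      case True
      then have "n - 2 * i - (j - i) = n - j - i" by simp
      with True j show ?thesis by (auto simp: w_def c_def algebra_simps)
    qed simp
    then show "(\<Sum>i\<le>k2. if i \<le> j then w i (j - i) else 0) =
        of_nat (octopus_gamma n m k2 j) * t ^ j * (1 + t) ^ (n - 2 * j)"
      unfolding octopus_gamma_def of_nat_sum sum_distrib_right by (intro sum.cong refl)
  qed
  finally show ?thesis by (simp only: U_def mult.assoc)
qed

lemma octopus_gamma_eq_binom:
  assumes "k \<le> n" "j \<le> n div 2"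
  shows "real (octopus_gamma n (n - k) k2 j) =
    (\<Sum>i=0..k2. 2 ^ i * binom (int k2) (int i) * binom (int n - int k) (int j - int i)
       * binom (int n - int j - int i) (int j - int i))"
proof -
  have binom: "binom (int a) (int b) = real (a choose b)" for a b
    by (simp add: binom_def binomial_gbinomial)
  have "real (if i \<le> j then 2 ^ i * (k2 choose i) * ((n - k) choose (j - i)) *
        ((n - j - i) choose (j - i)) else 0) =
      2 ^ i * binom (int k2) (int i) * binom (int n - int k) (int j - int i)
       * binom (int n - int j - int i) (int j - int i)" for i
  proof (cases "i \<le> j")
    case True
    have "int n - int k = int (n - k)" "int j - int i = int (j - i)"
      "int n - int j - int i = int (n - j - i)" using True assms by auto
    then show ?thesis using True by (simp only: binom) simp
  qed (simp add: binom_def)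
  then show ?thesis
    unfolding octopus_gamma_def of_nat_sum by (intro sum.cong) auto
qed

lemma gamma_expansion_octopus:
  assumes "k1 + 2 * k2 \<le> n"
  shows "gamma_expansion n (lopsided_octopus n k1 k2)
    (\<lambda>j. real (octopus_gamma n (n - (k1 + 2 * k2)) k2 j))"
proof -
  let ?k = "k1 + 2 * k2" and ?t = "monom 1 1 :: real poly"
  have "{1..n} = {1..?k} \<union> {?k + 1..n}" using assms by auto
  then have "h_poly n (lopsided_octopus n k1 k2) =
      coeff (([:1, 1 + ?t:]\<^sup>2 + [:0, 0, 2 * ?t:]) ^ k2 *
        ([:1, 1 + ?t:] ^ k1 * [:1, ?t:] ^ (n - ?k)) * [:1, 1:] ^ (n - ?k)) n"
    using diagonal_form_octopus[of "{?k + 1..n}" k1 k2 ?t] assms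
    by (simp only: h_poly_lopsided_octopus diagonal_form_def) auto
  also have "\<dots> = (\<Sum>j\<le>n div 2. of_nat (octopus_gamma n (n - ?k) k2 j) * ?t ^ j *
      (1 + ?t) ^ (n - 2 * j))"
    by (rule coeff_octopus) (use assms in simp)
  also have "1 + ?t = [:1, 1:]" by (simp add: monom_Suc monom_0 one_pCons)
  finally show ?thesis
    by (simp add: gamma_expansion_def monom_power of_nat_poly atMost_atLeast0)
qed

theorem proposition3p4:
  fixes n k1 k2 k :: nat and \<tau> :: arbor
  assumes "k = k1 + 2 * k2" and "k \<le> n"
    and "\<tau> = lopsided_octopus n k1 k2"
  shows "gamma_positive n \<tau> \<and>
    (\<forall>g. gamma_expansion n \<tau> g \<longrightarrow>
      (\<forall>j\<in>{0..n div 2}. g j =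
        (\<Sum>i=0..k2. 2 ^ i * binom (int k2) (int i) * binom (int n - int k) (int j - int i)
           * binom (int n - int j - int i) (int j - int i))))"
proof -
  have expansion: "gamma_expansion n \<tau> (\<lambda>j. real (octopus_gamma n (n - k) k2 j))"
    using gamma_expansion_octopus assms by simp
  then have "gamma_positive n \<tau>" unfolding gamma_positive_def by auto
  moreover have "g j = (\<Sum>i=0..k2. 2 ^ i * binom (int k2) (int i) *
      binom (int n - int k) (int j - int i) * binom (int n - int j - int i) (int j - int i))"
    if "gamma_expansion n \<tau> g" "j \<in> {0..n div 2}" for g j
    using gamma_coefficients_unique[OF that(1) expansion, of j] that(2)
      octopus_gamma_eq_binom[OF assms(2), of j k2] by simp
  ultimately show ?thesis by blast
qed

end
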